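(* Let $H$ be an infinite dimensional separable Hilbert space, and let $\mathcal{K}_1(H)$ denote the vector space of linear, selfadjoint and compact operators $S:H\to H$. For $S\in\mathcal{K}_1(H)$, let the eigenvalues of $S$ (counted with multiplicity) be arranged as $$\lambda_1(S)\geq \lambda_2(S)\geq\ldots\geq \lambda_n(S)\geq\ldots >0>\ldots \geq\lambda_{-n}(S)\geq\ldots\geq\lambda_{-2}(S)\geq\lambda_{-1}(S),$$ with the conventions given in the context when there are only finitely many positive or negative eigenvalues, and with $\lambda_0(S)=0$. Let $(\mu_n)_{n\in\mathbb{Z}}$ be real numbers such that $$\mu_1\geq\mu_2\geq\ldots\geq\mu_n\geq\ldots\geq \mu_{-n}\geq\ldots\geq\mu_{-2}\geq\mu_{-1}$$ and such that the series $\sum_{n=-\infty}^{\infty}\mu_n$ is absolutely convergent. Then the functional $\psi:\mathcal{K}_1(H)\to\mathbb{R}$ defined by $$\psi(S)=\sum_{n=-\infty}^{\infty}\mu_n\lambda_n(S)$$ is convex and lower semicontinuous (with respect to the operator norm on $\mathcal{K}_1(H)$).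
   Context: Arrangement of eigenvalues: for a compact selfadjoint operator $S$ on $H$, the positive eigenvalues, repeated according to multiplicity, are listed in nonincreasing order as $\lambda_1(S)\geq\lambda_2(S)\geq\ldots$, and the negative eigenvalues, repeated according to multiplicity, are listed in nondecreasing order as $\lambda_{-1}(S)\leq\lambda_{-2}(S)\leq\ldots$. If $S$ has only finitely many negative eigenvalues, say $n$ of them, they are denoted $\lambda_{-1}(S)\leq\ldots\leq\lambda_{-n}(S)$ and one sets $\lambda_{-k}(S)=0$ for all $k\geq n+1$; similarly, if $S$ has only finitely many positive eigenvalues, say $n$ of them, one sets $\lambda_k(S)=0$ for all $k\geq n+1$. The index $0$ corresponds to the value $\lambda_0(S)=0$. The chain of inequalities on $(\mu_n)$ means: $\mu_i\geq\mu_{i+1}$ for all $i\geq 1$, $\mu_{-i-1}\geq\mu_{-i}$ for all $i\geq 1$, and $\mu_i\geq\mu_{-j}$ for all $i,j\geq 1$. Lower semicontinuous means: $\psi(S)\leq\liminf_{n\to\infty}\psi(S_n)$ whenever $S,S_n\in\mathcal{K}_1(H)$ and $\|S_n-S\|\to 0$ in operator norm. *)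

theory Defs
  imports "HOL-Analysis.Analysis"
begin

(* The scalar field of the Hilbert space, treated uniformly for the real and the complex case.
   The axioms give z + conj z = norm (1 + z) ^ 2 - 1 - norm z ^ 2, so every element is a root of
   the real quadratic X ^ 2 - (z + conj z) X + norm z ^ 2. Hence up to isomorphism the only
   instances are the reals with the identity and the complex numbers with complex conjugation. *)

class real_or_complex = real_normed_field +
  fixes conj :: "'a \<Rightarrow> 'a"
  assumes conj_add: "conj (x + y) = conj x + conj y"
    and mult_conj: "x * conj x = (norm x)\<^sup>2 *\<^sub>R 1"

instantiation real :: real_or_complex
begin
definition conj_real :: "real \<Rightarrow> real" where "conj_real x = x"
instance by standard (auto simp: conj_real_def power2_eq_square)
end

instantiation complex :: real_or_complex
begin
definition conj_complex :: "complex \<Rightarrow> complex" where "conj_complex z = cnj z"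
instance by standard (simp_all add: conj_complex_def scaleR_conv_of_real complex_norm_square del: of_real_power)
end

(* The underlying real Banach space is the type 'a; the locale adds the scalar multiplication and
   an inner product (linear in its first argument) that induces the norm. *)

locale hilbert_space = vector_space smul
  for smul :: "'k::real_or_complex \<Rightarrow> 'a::banach \<Rightarrow> 'a" +
  fixes ip :: "'a \<Rightarrow> 'a \<Rightarrow> 'k"
  assumes smul_of_real: "smul (of_real r) x = r *\<^sub>R x"
    and ip_add_left: "ip (x + y) z = ip x z + ip y z"
    and ip_smul_left: "ip (smul c x) y = c * ip x y"
    and ip_conj: "ip y x = conj (ip x y)"
    and ip_self: "ip x x = of_real ((norm x)\<^sup>2)"

lemma hilbert_space_real:
  "hilbert_space (scaleR :: real \<Rightarrow> 'a::{real_inner, banach} \<Rightarrow> 'a) inner"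
  by unfold_locales
    (auto simp: conj_real_def algebra_simps inner_commute power2_norm_eq_inner)

lemma hilbert_space_complex: "hilbert_space ((*) :: complex \<Rightarrow> complex \<Rightarrow> complex) (\<lambda>x y. x * cnj y)"
  by unfold_locales
    (auto simp: conj_complex_def algebra_simps scaleR_conv_of_real complex_norm_square
      simp del: of_real_power)

definition infinite_dimensional :: "('k::field \<Rightarrow> 'a::ab_group_add \<Rightarrow> 'a) \<Rightarrow> bool" where
  "infinite_dimensional smul \<longleftrightarrow> \<not> (\<exists>B. finite B \<and> module.span smul B = UNIV)"

definition compact_operator :: "('a::real_normed_vector \<Rightarrow> 'b::real_normed_vector) \<Rightarrow> bool" where
  "compact_operator f \<longleftrightarrow> (\<forall>B. bounded B \<longrightarrow> compact (closure (f ` B)))"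

(* Compact linear operators are bounded, so the type of bounded (real-)linear operators,
   which carries the operator norm, loses nothing. *)

definition K1 :: "('k::real_or_complex \<Rightarrow> 'a::banach \<Rightarrow> 'a) \<Rightarrow> ('a \<Rightarrow> 'a \<Rightarrow> 'k) \<Rightarrow> ('a \<Rightarrow>\<^sub>L 'a) set"
  where
  "K1 smul ip = {S. Vector_Spaces.linear smul smul (blinfun_apply S)
     \<and> (\<forall>x y. ip (blinfun_apply S x) y = ip x (blinfun_apply S y))
     \<and> compact_operator (blinfun_apply S)}"

definition eigenspace ::
  "('k::real_or_complex \<Rightarrow> 'a::banach \<Rightarrow> 'a) \<Rightarrow> ('a \<Rightarrow>\<^sub>L 'a) \<Rightarrow> real \<Rightarrow> 'a set" where
  "eigenspace smul S r = {x. blinfun_apply S x = smul (of_real r) x}"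

(* lam lists the positive eigenvalues nonincreasingly at 1, 2, ... and the negative ones
   nondecreasingly at -1, -2, ..., each nonzero r occurring as often as its multiplicity
   (zero times if r is not an eigenvalue); the remaining entries are then forced to be 0.
   Finiteness is required because card of an infinite set is 0. *)

definition eigenvalue_arrangement ::
  "('k::real_or_complex \<Rightarrow> 'a::banach \<Rightarrow> 'a) \<Rightarrow> ('a \<Rightarrow>\<^sub>L 'a) \<Rightarrow> (int \<Rightarrow> real) \<Rightarrow> bool" where
  "eigenvalue_arrangement smul S lam \<longleftrightarrow>
     lam 0 = 0
   \<and> (\<forall>i\<ge>1. lam i \<ge> lam (i + 1) \<and> lam i \<ge> 0)
   \<and> (\<forall>i\<ge>1. lam (- i) \<le> lam (- i - 1) \<and> lam (- i) \<le> 0)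
   \<and> (\<forall>r. r \<noteq> 0 \<longrightarrow> finite {n. lam n = r}
        \<and> card {n. lam n = r} = vector_space.dim smul (eigenspace smul S r))"

definition eigval ::
  "('k::real_or_complex \<Rightarrow> 'a::banach \<Rightarrow> 'a) \<Rightarrow> ('a \<Rightarrow>\<^sub>L 'a) \<Rightarrow> int \<Rightarrow> real" where
  "eigval smul S = (THE lam. eigenvalue_arrangement smul S lam)"

definition spectral_functional ::
  "('k::real_or_complex \<Rightarrow> 'a::banach \<Rightarrow> 'a) \<Rightarrow> (int \<Rightarrow> real) \<Rightarrow> ('a \<Rightarrow>\<^sub>L 'a) \<Rightarrow> real" where
  "spectral_functional smul \<mu> S = (\<Sum>\<^sub>\<infinity>n\<in>UNIV. \<mu> n * eigval smul S n)"

definition lower_semicontinuous_on :: "'b::metric_space set \<Rightarrow> ('b \<Rightarrow> real) \<Rightarrow> bool" where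
  "lower_semicontinuous_on A f \<longleftrightarrow>
     (\<forall>x\<in>A. \<forall>xs. (\<forall>n. xs n \<in> A) \<longrightarrow> xs \<longlonglongrightarrow> x \<longrightarrow>
        ereal (f x) \<le> liminf (\<lambda>n. ereal (f (xs n))))"

end

theory Submission
  imports Defs
begin

text \<open>Since \<open>\<mu>\<close> is summable and monotone on either side, \<open>\<mu> n \<ge> 0\<close> for \<open>n \<ge> 1\<close> and \<open>\<mu> n \<le> 0\<close> for
  \<open>n \<le> -1\<close>. As the negative eigenvalues of \<open>S\<close> are the positive ones of \<open>- S\<close>, the functional is a
  sum of two functionals of the form \<open>\<Sum>k. m k * \<lambda>\<^sub>k(S)\<close>, at \<open>S\<close> and at \<open>- S\<close>, with \<open>m\<close>
  nonincreasing and nonnegative. By Ky Fan's principle \<open>\<lambda>\<^sub>1 + \<dots> + \<lambda>\<^sub>k\<close> is the maximum of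
  \<open>\<Sum>j. \<langle>S g\<^sub>j, g\<^sub>j\<rangle>\<close> over systems of \<open>k\<close> pairwise orthogonal vectors of norm 1 or 0, so it is sublinear
  in \<open>S\<close> and Lipschitz with constant \<open>k\<close>. Abel summation transfers both properties to the weighted
  sums, which are therefore convex and even Lipschitz with constant \<open>\<Sum>k. m k\<close>. The eigenvectors
  behind Ky Fan's principle are found one by one, maximizing the Rayleigh quotient on the orthogonal
  complement of the previous ones.\<close>

subsection \<open>Sequences and series\<close>

text \<open>Abel summation: if d = b - a has partial sums D_k \<ge> 0, the weighted sum of d up to k
  is \<mu>_k D_k plus the nonnegative terms (\<mu>_i - \<mu>_(i+1)) D_(i+1).\<close>

lemma weighted_sum_mono:
  fixes a b \<mu> :: "nat \<Rightarrow> real"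
  assumes dec: "\<And>i. \<mu> (Suc i) \<le> \<mu> i" and nonneg: "\<And>i. 0 \<le> \<mu> i"
    and partial: "\<And>k. (\<Sum>i<k. a i) \<le> (\<Sum>i<k. b i)"
  shows "(\<Sum>i<k. \<mu> i * a i) \<le> (\<Sum>i<k. \<mu> i * b i)"
proof -
  \<comment> \<open>Keeping the boundary term on the left makes the induction work with monotone
    weights alone; their sign enters only afterwards, to discard it.\<close>
  have "\<mu> k * (\<Sum>i<k. b i - a i) \<le> (\<Sum>i<k. \<mu> i * (b i - a i))"
  proof (induction k)
    case (Suc k)
    have "0 \<le> (\<Sum>i<Suc k. b i - a i)"
      using partial[of "Suc k"] by (simp add: sum_subtractf)
    then have "\<mu> (Suc k) * (\<Sum>i<Suc k. b i - a i) \<le> \<mu> k * (\<Sum>i<Suc k. b i - a i)"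
      using dec mult_right_mono by blast
    with Suc show ?case by (simp add: algebra_simps)
  qed simp
  moreover have "0 \<le> \<mu> k * (\<Sum>i<k. b i - a i)"
    using nonneg partial[of k] by (simp add: sum_subtractf)
  ultimately show ?thesis by (simp add: right_diff_distrib sum_subtractf)
qed

lemma weighted_suminf_mono:
  fixes a b \<mu> :: "nat \<Rightarrow> real"
  assumes "\<And>i. \<mu> (Suc i) \<le> \<mu> i" and "\<And>i. 0 \<le> \<mu> i"
    and "\<And>k. (\<Sum>i<k. a i) \<le> (\<Sum>i<k. b i)"
    and "summable (\<lambda>i. \<mu> i * a i)" and "summable (\<lambda>i. \<mu> i * b i)"
  shows "(\<Sum>i. \<mu> i * a i) \<le> (\<Sum>i. \<mu> i * b i)"
  using LIMSEQ_le[OF summable_LIMSEQ[OF assms(4)] summable_LIMSEQ[OF assms(5)]]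
    weighted_sum_mono[of \<mu> a b, OF assms(1-3)] by blast

text \<open>Suppose a n < b n at the first difference. Every index where \<open>a\<close> takes the
  value b n lies before n, where the sequences agree, while \<open>b\<close> takes it at n as well,
  so the level sets differ in size. That value is positive, so the possibly infinite level of 0
  never matters.\<close>

lemma decseq_eq_if_level_cards_eq:
  fixes a b :: "nat \<Rightarrow> real"
  assumes "decseq a" "decseq b" "\<And>n. 0 \<le> a n" "\<And>n. 0 \<le> b n"
    and fin: "\<And>r. 0 < r \<Longrightarrow> finite {n. a n = r}" "\<And>r. 0 < r \<Longrightarrow> finite {n. b n = r}"
    and card: "\<And>r. 0 < r \<Longrightarrow> card {n. a n = r} = card {n. b n = r}"
  shows "a = b"
proof -
  have no_first_less: False
    if a: "decseq a" and pos: "0 \<le> a n" and less: "a n < b n" and eq: "\<And>i. i < n \<Longrightarrow> a i = b i"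
      and fin: "\<And>r. 0 < r \<Longrightarrow> finite {n. b n = r}"
      and card: "\<And>r. 0 < r \<Longrightarrow> card {n. a n = r} = card {n. b n = r}"
    for a b :: "nat \<Rightarrow> real" and n
  proof -
    have "i < n" if "a i = b n" for i
      using decseqD[OF a, of n i] less that by (cases "i < n") auto
    then have "{i. a i = b n} \<subseteq> {i. b i = b n}" "n \<notin> {i. a i = b n}" "n \<in> {i. b i = b n}"
      using less by (auto simp flip: eq)
    then have "{i. a i = b n} \<subset> {i. b i = b n}" by blast
    moreover have "0 < b n" using pos less by simp
    ultimately show False
      using psubset_card_mono[OF fin] card by (metis less_irrefl)
  qed
  show ?thesis
  proof (rule ccontr)
    assume "a \<noteq> b"
    then obtain n where n: "a n \<noteq> b n" "\<And>i. i < n \<Longrightarrow> a i = b i"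
      using exists_least_iff[of "\<lambda>n. a n \<noteq> b n"] by auto
    then consider "a n < b n" | "b n < a n" by linarith
    then show False
    proof cases
      case 1
      show False by (rule no_first_less[of a n b]) (use assms 1 n in auto)
    next
      case 2
      show False by (rule no_first_less[of b n a]) (use assms 2 n in auto)
    qed
  qed
qed

text \<open>Turns the unordered sum into two ordinary series, to which Abel summation applies. From
  here on the natural index k stands for the integer k + 1 or - k - 1.\<close>

lemma infsum_int_split:
  fixes g :: "int \<Rightarrow> real"
  assumes g: "g summable_on UNIV" and "g 0 = 0"
  shows "infsum g UNIV = (\<Sum>k. g (int k + 1)) + (\<Sum>k. g (- int k - 1))"
proof -
  let ?p = "\<lambda>k. int k + 1" and ?m = "\<lambda>k. - int k - 1"
  have inj: "inj ?p" "inj ?m" by (auto simp: inj_on_def)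
  have summable: "g summable_on A" for A
    using summable_on_subset_banach[OF g] by blast
  have half: "infsum g (range h) = (\<Sum>k. g (h k))" if "inj h" for h :: "nat \<Rightarrow> int"
  proof -
    have "(g \<circ> h) summable_on UNIV" using summable summable_on_reindex[OF that] by blast
    from has_sum_imp_sums[OF has_sum_infsum[OF this]] show ?thesis
      by (simp add: infsum_reindex[OF that] sums_iff o_def)
  qed
  have "n \<in> range ?p \<union> range ?m" if "n \<noteq> 0" for n
  proof (cases "n > 0")
    case True
    then have "n = ?p (nat (n - 1))" by simp
    then show ?thesis by blast
  next
    case False
    with that have "n = ?m (nat (- n - 1))" by simp
    then show ?thesis by blast
  qed
  then have zero: "g n = 0" if "n \<notin> range ?p \<union> range ?m" for n
    using assms(2) that by metis
  have "infsum g UNIV = infsum g (range ?p \<union> range ?m)"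
    by (rule infsum_cong_neutral) (use zero in auto)
  also have "\<dots> = infsum g (range ?p) + infsum g (range ?m)"
    by (intro infsum_Un_disjoint summable) auto
  finally show ?thesis by (simp add: half[OF inj(1)] half[OF inj(2)])
qed

subsection \<open>Compact operators\<close>

text \<open>The image lies in the sum of two compact closures, which is compact and hence closed, so
  its closure stays inside.\<close>

lemma compact_operator_add:
  assumes "compact_operator f" "compact_operator g"
  shows "compact_operator (\<lambda>x. f x + g x)"
  unfolding compact_operator_def
proof (intro allI impI)
  fix B :: "'a set"
  assume "bounded B"
  let ?C = "{x + y | x y. x \<in> closure (f ` B) \<and> y \<in> closure (g ` B)}"
  have C: "compact ?C"
    using assms \<open>bounded B\<close> by (intro compact_sums) (auto simp: compact_operator_def)
  have "(\<lambda>x. f x + g x) ` B \<subseteq> ?C"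
    using closure_subset[of "f ` B"] closure_subset[of "g ` B"] by blast
  then have "closure ((\<lambda>x. f x + g x) ` B) \<subseteq> ?C"
    using C by (simp add: closure_minimal compact_imp_closed)
  then have "?C \<inter> closure ((\<lambda>x. f x + g x) ` B) = closure ((\<lambda>x. f x + g x) ` B)"
    by (rule inf.absorb2)
  then show "compact (closure ((\<lambda>x. f x + g x) ` B))"
    using compact_Int_closed[OF C closed_closure[of "(\<lambda>x. f x + g x) ` B"]] by (simp only:)
qed

lemma compact_operator_scaleR:
  assumes "compact_operator f"
  shows "compact_operator (\<lambda>x. c *\<^sub>R f x)"
  unfolding compact_operator_def
proof (intro allI impI)
  fix B :: "'a set"
  assume "bounded B"
  then have "compact ((*\<^sub>R) c ` closure (f ` B))"
    using assms by (intro compact_scaling) (auto simp: compact_operator_def)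
  then show "compact (closure ((\<lambda>x. c *\<^sub>R f x) ` B))"
    by (simp add: closure_scaleR image_image)
qed

subsection \<open>The inner product\<close>

lemma conj_zero [simp]: "conj (0::'k::real_or_complex) = 0"
  using conj_add[of 0 "0::'k"] by simp

lemma norm_conj [simp]: "norm (conj x) = norm (x::'k::real_or_complex)"
proof (cases "x = 0")
  case False
  have "norm x * norm (conj x) = norm x * norm x"
    using arg_cong[OF mult_conj[of x], of norm] by (simp add: norm_mult power2_eq_square)
  with False show ?thesis by simp
qed simp

lemma conj_of_real [simp]: "conj (of_real r :: 'k::real_or_complex) = of_real r"
proof (cases "r = 0")
  case False
  have "of_real r * conj (of_real r :: 'k) = of_real r * of_real r"
    using mult_conj[of "of_real r :: 'k"] by (simp add: power2_eq_square scaleR_conv_of_real)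
  with False show ?thesis by simp
qed simp

context hilbert_space
begin

lemma ip_zero_left [simp]: "ip 0 y = 0"
  using ip_add_left[of 0 0 y] by simp

lemma ip_add_right: "ip x (y + z) = ip x y + ip x z"
  by (metis ip_add_left ip_conj conj_add)

lemma ip_zero_right [simp]: "ip x 0 = 0"
  using ip_add_right[of x 0 0] by simp

lemma ip_diff_left: "ip (x - y) z = ip x z - ip y z"
  using ip_add_left[of "x - y" y z] by simp

lemma ip_sum_left: "ip (sum f A) z = (\<Sum>i\<in>A. ip (f i) z)"
  by (induction A rule: infinite_finite_induct) (auto simp: ip_add_left)

lemma ip_scaleR_left: "ip (r *\<^sub>R x) y = of_real r * ip x y"
  by (metis smul_of_real ip_smul_left)

lemma ip_eq_0_commute: "ip x y = 0 \<longleftrightarrow> ip y x = 0"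
  by (metis ip_conj conj_zero)

lemma ip_scaleR_right: "ip x (r *\<^sub>R y) = of_real r * ip x y"
proof -
  \<comment> \<open>The class axioms give only additivity of \<open>conj\<close> and the value of
    \<open>x * conj x\<close>. Real factors still come out: both sides agree after multiplication by
    \<open>of_real r * z\<close>, which can be cancelled.\<close>
  have *: "conj (of_real r * z) = of_real r * conj z" for z :: 'k
  proof (cases "r = 0 \<or> z = 0")
    case False
    have "(of_real r * z) * conj (of_real r * z) = of_real (r\<^sup>2 * (norm z)\<^sup>2)"
      by (simp only: mult_conj scaleR_conv_of_real norm_mult norm_of_real power_mult_distrib
          power2_abs mult_1_right)
    also have "\<dots> = of_real r * of_real r * (z * conj z)"
      by (simp add: mult_conj scaleR_conv_of_real power2_eq_square)
    finally have "(of_real r * z) * conj (of_real r * z) = (of_real r * z) * (of_real r * conj z)"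
      by (simp only: ac_simps)
    with False show ?thesis by simp
  qed auto
  show ?thesis
    by (metis * ip_conj ip_scaleR_left)
qed

text \<open>The real part of \<open>ip\<close>, defined by polarization since the scalar class has no real part.\<close>

definition rip :: "'a \<Rightarrow> 'a \<Rightarrow> real" where
  "rip x y = ((norm (x + y))\<^sup>2 - (norm x)\<^sup>2 - (norm y)\<^sup>2) / 2"

lemma of_real_rip: "of_real (2 * rip x y) = ip x y + ip y x"
proof -
  have "of_real ((norm (x + y))\<^sup>2) = of_real ((norm x)\<^sup>2) + of_real ((norm y)\<^sup>2) + (ip x y + ip y x)"
    unfolding ip_self[symmetric] by (simp add: ip_add_left ip_add_right)
  then show ?thesis by (simp add: rip_def)
qed

text \<open>As \<open>of_real\<close> is injective, identities for \<open>rip\<close> can be checked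
  on the symmetrized \<open>ip\<close>; this yields bilinearity despite the definition by
  norms.\<close>

lemma rip_eqI: "ip x y + ip y x = of_real (2 * c) \<Longrightarrow> rip x y = c"
  by (metis of_real_rip of_real_eq_iff mult_cancel_left zero_neq_numeral)

lemma rip_commute: "rip x y = rip y x"
  by (simp add: rip_def add.commute algebra_simps)

lemma rip_add_left: "rip (x + y) z = rip x z + rip y z"
  by (rule rip_eqI) (simp only: distrib_left of_real_add of_real_rip ip_add_left ip_add_right, simp)

lemma rip_add_right: "rip z (x + y) = rip z x + rip z y"
  by (simp add: rip_commute[of z] rip_add_left)

lemma rip_scaleR_left: "rip (r *\<^sub>R x) z = r * rip x z"
  by (rule rip_eqI)
    (simp only: mult.left_commute[of 2 r] of_real_mult[of r] of_real_rip ip_scaleR_left ip_scaleR_right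
      distrib_left)

lemma rip_scaleR_right: "rip z (r *\<^sub>R x) = r * rip z x"
  by (simp add: rip_commute[of z] rip_scaleR_left)

lemma rip_diff_left: "rip (x - y) z = rip x z - rip y z"
  using rip_add_left[of "x - y" y z] by simp

lemma rip_diff_right: "rip z (x - y) = rip z x - rip z y"
  by (simp add: rip_commute[of z] rip_diff_left)

lemma rip_self: "rip x x = (norm x)\<^sup>2"
  by (rule rip_eqI) (simp add: ip_self)

lemma rip_eq_0: "ip x y = 0 \<Longrightarrow> rip x y = 0"
  using ip_eq_0_commute by (intro rip_eqI) auto

text \<open>Cauchy-Schwarz is here the squared triangle inequality, since \<open>rip\<close> is
  defined by the norm.\<close>

lemma rip_le_norm: "rip x y \<le> norm x * norm y"
proof -
  have "(norm (x + y))\<^sup>2 \<le> (norm x + norm y)\<^sup>2"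
    by (intro power_mono norm_triangle_ineq norm_ge_zero)
  then show ?thesis by (simp add: rip_def power2_sum)
qed

lemma rip_blinfun_le: "rip (blinfun_apply S x) x \<le> norm S * (norm x)\<^sup>2"
proof -
  have "rip (blinfun_apply S x) x \<le> norm (blinfun_apply S x) * norm x" by (rule rip_le_norm)
  also have "\<dots> \<le> (norm S * norm x) * norm x"
    by (intro mult_right_mono norm_blinfun) auto
  finally show ?thesis by (simp add: power2_eq_square mult.assoc)
qed

subsection \<open>Eigenvectors by maximization\<close>

lemma K1_smul: "S \<in> K1 smul ip \<Longrightarrow> blinfun_apply S (smul c x) = smul c (blinfun_apply S x)"
  by (simp add: K1_def Vector_Spaces.linear_iff)

lemma K1_ip: "S \<in> K1 smul ip \<Longrightarrow> ip (blinfun_apply S x) y = ip x (blinfun_apply S y)"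
  by (simp add: K1_def)

lemma K1_rip: "S \<in> K1 smul ip \<Longrightarrow> rip (blinfun_apply S x) y = rip x (blinfun_apply S y)"
  by (rule rip_eqI) (simp only: of_real_rip K1_ip)

lemma K1_convergent_subseq:
  assumes S: "S \<in> K1 smul ip" and "\<And>n. norm (x n) \<le> B"
  shows "\<exists>z r. strict_mono (r :: nat \<Rightarrow> nat) \<and> (\<lambda>n. blinfun_apply S (x (r n))) \<longlonglongrightarrow> z"
proof -
  have "compact (closure (blinfun_apply S ` cball 0 B))"
    using S by (auto simp: K1_def compact_operator_def)
  moreover have "blinfun_apply S (x n) \<in> closure (blinfun_apply S ` cball 0 B)" for n
    using assms(2) by (intro subsetD[OF closure_subset]) auto
  ultimately obtain z r where "strict_mono (r :: nat \<Rightarrow> nat)" "((\<lambda>n. blinfun_apply S (x n)) \<circ> r) \<longlonglongrightarrow> z"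
    using seq_compactE[OF compact_imp_seq_compact] by metis
  then show ?thesis by (auto simp: o_def)
qed

text \<open>With \<open>M\<close> the supremum of the Rayleigh quotient on \<open>V\<close>, the operator \<open>T = M - S\<close> is positive
  on \<open>V\<close>, and minimizing the form of \<open>T\<close> along \<open>x - t T x\<close> bounds \<open>T x\<close> by the form at \<open>x\<close>. So \<open>T\<close>
  tends to 0 along a maximizing sequence, which has a convergent subsequence since \<open>S\<close> is compact.\<close>

lemma exists_maximizing_eigenvector:
  assumes S: "S \<in> K1 smul ip" and V: "Real_Vector_Spaces.subspace V" "closed V"
    and inv: "\<And>x. x \<in> V \<Longrightarrow> blinfun_apply S x \<in> V"
  shows "\<exists>g\<in>V. \<exists>M. blinfun_apply S g = M *\<^sub>R g \<and> (norm g = 1 \<and> M > 0 \<or> g = 0 \<and> M = 0)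
     \<and> (\<forall>x\<in>V. rip (blinfun_apply S x) x \<le> M * (norm x)\<^sup>2)"
proof (cases "\<forall>x\<in>V. rip (blinfun_apply S x) x \<le> 0")
  \<comment> \<open>With a nonpositive form there is no positive eigenvalue left on
    \<open>V\<close>, and the padding pair 0, 0 is the answer.\<close>
  case True
  moreover have "0 \<in> V" using V real_vector.subspace_0 by blast
  ultimately show ?thesis
    by (intro bexI[of _ 0] exI[of _ 0]) (auto simp: blinfun.zero_right)
next
  case False
  define R where "R = (\<lambda>x. rip (blinfun_apply S x) x) ` {x\<in>V. norm x = 1}"
  define M where "M = Sup R"
  have bdd: "bdd_above R"
    unfolding R_def
  proof (rule bdd_aboveI2)
    show "rip (blinfun_apply S x) x \<le> norm S" if "x \<in> {x\<in>V. norm x = 1}" for x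
      using rip_blinfun_le[of S x] that by simp
  qed
  have scale: "inverse (norm x) *\<^sub>R x \<in> V" if "x \<in> V" for x
    using V that by (auto intro: real_vector.subspace_scale)
  have norm_R: "rip (blinfun_apply S x) x / (norm x)\<^sup>2 \<in> R" if "x \<in> V" "x \<noteq> 0" for x
    unfolding R_def using scale[OF that(1)] that(2)
    by (intro image_eqI[of _ _ "inverse (norm x) *\<^sub>R x"])
      (auto simp: blinfun.scaleR_right rip_scaleR_left rip_scaleR_right field_simps power2_eq_square)
  have M_ub: "rip (blinfun_apply S x) x \<le> M * (norm x)\<^sup>2" if "x \<in> V" for x
  proof (cases "x = 0")
    case True
    then show ?thesis by (simp add: blinfun.zero_right rip_self)
  next
    case False
    then have "rip (blinfun_apply S x) x / (norm x)\<^sup>2 \<le> M"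
      unfolding M_def using norm_R bdd that cSup_upper by blast
    with False show ?thesis by (simp add: field_simps)
  qed
  obtain x0 where x0: "x0 \<in> V" "rip (blinfun_apply S x0) x0 > 0" using False by force
  then have M_pos: "M > 0"
    using M_ub[OF x0(1)] by (smt (verit) mult_nonpos_nonneg zero_le_power2)
  have "x0 \<noteq> 0" using x0 by (auto simp: rip_self)
  then have "R \<noteq> {}" using norm_R x0 by blast
  then have "\<exists>x\<in>V. norm x = 1 \<and> rip (blinfun_apply S x) x > M - inverse (Suc n)" for n
    using less_cSupE[of "M - inverse (Suc n)" R] by (auto simp: M_def R_def)
  then obtain x where x: "\<And>n. x n \<in> V" "\<And>n. norm (x n) = 1"
      "\<And>n. rip (blinfun_apply S (x n)) (x n) > M - inverse (Suc n)"
    by metis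
  define T where "T y = M *\<^sub>R y - blinfun_apply S y" for y
  define C where "C = M + norm S"
  have C: "C > 0" using M_pos by (simp add: C_def add_pos_nonneg)
  have T_V: "T y \<in> V" if "y \<in> V" for y
    unfolding T_def using V inv that
    by (auto intro: real_vector.subspace_diff real_vector.subspace_scale)
  have T_lin: "T (y - t *\<^sub>R z) = T y - t *\<^sub>R T z" for y z t
    by (simp add: T_def blinfun.diff_right blinfun.scaleR_right algebra_simps)
  have T_sym: "rip (T y) z = rip y (T z)" for y z
    by (simp add: T_def rip_diff_left rip_diff_right rip_scaleR_left rip_scaleR_right K1_rip[OF S])
  have T_ge: "0 \<le> rip (T y) y" if "y \<in> V" for y
    using M_ub[OF that] by (simp add: T_def rip_diff_left rip_scaleR_left rip_self)
  have T_le: "rip (T y) y \<le> C * (norm y)\<^sup>2" for y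
  proof -
    have "rip (blinfun_apply (- S) y) y \<le> norm S * (norm y)\<^sup>2"
      using rip_blinfun_le[of "- S" y] by simp
    moreover have "rip (blinfun_apply (- S) y) y = - rip (blinfun_apply S y) y"
      using rip_scaleR_left[of "-1" "blinfun_apply S y" y] by (simp add: blinfun.minus_left)
    ultimately show ?thesis
      by (simp add: T_def C_def rip_diff_left rip_scaleR_left rip_self algebra_simps)
  qed
  have T_bound: "(norm (T y))\<^sup>2 \<le> C * rip (T y) y" if "y \<in> V" for y
  proof -
    \<comment> \<open>With q the squared norm of \<open>T y\<close>, the bound - 2 t q + C t^2 q is
      smallest at t = 1 / C, where it equals - q / C.\<close>
    let ?t = "1 / C"
    have "y - ?t *\<^sub>R T y \<in> V"
      using V T_V that by (auto intro: real_vector.subspace_diff real_vector.subspace_scale)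
    from T_ge[OF this] have "0 \<le> rip (T y) y - 2 * ?t * (norm (T y))\<^sup>2 + ?t\<^sup>2 * rip (T (T y)) (T y)"
      by (simp add: T_lin rip_diff_left rip_diff_right rip_scaleR_left rip_scaleR_right
          T_sym[of "T y" y] rip_self power2_eq_square algebra_simps)
    also have "\<dots> \<le> rip (T y) y - 2 * ?t * (norm (T y))\<^sup>2 + ?t\<^sup>2 * (C * (norm (T y))\<^sup>2)"
      by (intro add_left_mono mult_left_mono T_le) auto
    also have "\<dots> = rip (T y) y - ?t * (norm (T y))\<^sup>2"
      using C by (simp add: power2_eq_square)
    finally show ?thesis using C by (simp add: field_simps)
  qed
  have T_x: "norm ((norm (T (x n)))\<^sup>2) \<le> C * inverse (real (Suc n))" for n
  proof -
    have "rip (T (x n)) (x n) \<le> inverse (real (Suc n))"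
      using x(3)[of n] x(2)[of n] by (simp add: T_def rip_diff_left rip_scaleR_left rip_self)
    then have "C * rip (T (x n)) (x n) \<le> C * inverse (real (Suc n))"
      using C by (intro mult_left_mono) auto
    then show ?thesis using order_trans[OF T_bound[OF x(1)]] by simp
  qed
  have "(\<lambda>n. C * inverse (real (Suc n))) \<longlonglongrightarrow> 0"
    using tendsto_mult_left[OF LIMSEQ_inverse_real_of_nat, of C] by simp
  then have "(\<lambda>n. (norm (T (x n)))\<^sup>2) \<longlonglongrightarrow> 0"
    by (rule Lim_null_comparison[OF always_eventually[OF allI[OF T_x]]])
  then have "(\<lambda>n. sqrt ((norm (T (x n)))\<^sup>2)) \<longlonglongrightarrow> sqrt 0"
    by (rule tendsto_real_sqrt)
  then have T_lim: "(\<lambda>n. T (x n)) \<longlonglongrightarrow> 0"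
    by (simp add: tendsto_norm_zero_iff)
  obtain z r where r: "strict_mono (r :: nat \<Rightarrow> nat)"
      and z: "(\<lambda>n. blinfun_apply S (x (r n))) \<longlonglongrightarrow> z"
    using K1_convergent_subseq[OF S, of x 1] x(2) by (metis order_refl)
  have T_lim': "(\<lambda>n. T (x (r n))) \<longlonglongrightarrow> 0"
    using LIMSEQ_subseq_LIMSEQ[OF T_lim r] by (simp add: o_def)
  \<comment> \<open>Since M x = T x + S x, convergence of both summands forces convergence of
    \<open>x (r n)\<close> itself; the 0 is the limit of \<open>T (x (r n))\<close>.\<close>
  define g where "g = inverse M *\<^sub>R (0 + z)"
  have "(\<lambda>n. inverse M *\<^sub>R (T (x (r n)) + blinfun_apply S (x (r n)))) \<longlonglongrightarrow> g"
    unfolding g_def by (intro tendsto_intros T_lim' z)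
  then have g: "(\<lambda>n. x (r n)) \<longlonglongrightarrow> g"
    using M_pos by (simp add: T_def)
  have "(\<lambda>n. T (x (r n))) \<longlonglongrightarrow> T g"
    unfolding T_def by (intro tendsto_intros g)
  then have "T g = 0" using T_lim' LIMSEQ_unique by blast
  then have "blinfun_apply S g = M *\<^sub>R g" by (simp add: T_def)
  moreover have "g \<in> V" using closed_sequentially[OF V(2) _ g] x by blast
  moreover have "norm g = 1" using tendsto_norm[OF g] x(2) by (simp add: LIMSEQ_const_iff)
  ultimately show ?thesis
    using M_pos M_ub by blast
qed

subsection \<open>Orthonormal systems\<close>

definition orthonormal_or_zero :: "'i set \<Rightarrow> ('i \<Rightarrow> 'a) \<Rightarrow> bool" where
  "orthonormal_or_zero A e \<longleftrightarrow>
     (\<forall>i\<in>A. \<forall>j\<in>A. i \<noteq> j \<longrightarrow> ip (e i) (e j) = 0) \<and> (\<forall>i\<in>A. norm (e i) = 1 \<or> e i = 0)"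

lemma orthonormal_or_zero_subset:
  "orthonormal_or_zero B e \<Longrightarrow> A \<subseteq> B \<Longrightarrow> orthonormal_or_zero A e"
  by (auto simp: orthonormal_or_zero_def)

lemma ip_orthonormal_sum:
  assumes e: "orthonormal_or_zero A e" and "finite A" "i \<in> A"
  shows "ip (\<Sum>j\<in>A. smul (c j) (e j)) (e i) = c i * ip (e i) (e i)"
proof -
  have "ip (\<Sum>j\<in>A. smul (c j) (e j)) (e i) = (\<Sum>j\<in>A. if j = i then c i * ip (e i) (e i) else 0)"
    using e \<open>i \<in> A\<close> by (auto simp: ip_sum_left ip_smul_left orthonormal_or_zero_def intro!: sum.cong)
  with assms show ?thesis by simp
qed

section \<open>Orthogonal projections and Bessel's inequality\<close>

definition orthogonal_projection :: "('i \<Rightarrow> 'a) \<Rightarrow> 'i set \<Rightarrow> 'a \<Rightarrow> 'a" where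
  "orthogonal_projection e A x = (\<Sum>i\<in>A. smul (ip x (e i)) (e i))"

lemma ip_diff_projection:
  assumes "orthonormal_or_zero A e" "finite A" "i \<in> A"
  shows "ip (x - orthogonal_projection e A x) (e i) = 0"
proof -
  have "norm (e i) = 1 \<or> e i = 0" using assms by (auto simp: orthonormal_or_zero_def)
  then have "ip x (e i) * ip (e i) (e i) = ip x (e i)" by (auto simp: ip_self)
  then show ?thesis
    using ip_orthonormal_sum[OF assms] by (simp add: ip_diff_left orthogonal_projection_def)
qed

text \<open>If \<open>e i\<close> is an eigenvector of an operator with eigenvalue
  \<open>l i\<close>, then \<open>w\<close> is the image of the projection; with weights 1 it is the
  projection itself. One computation thus serves both the quadratic form and Pythagoras.\<close>

lemma ip_weighted_projection:
  fixes e :: "'i \<Rightarrow> 'a" and l :: "'i \<Rightarrow> real" and x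
  assumes e: "orthonormal_or_zero A e" "finite A"
  defines "w \<equiv> \<Sum>i\<in>A. smul (ip x (e i)) (l i *\<^sub>R e i)"
  shows "rip w (orthogonal_projection e A x) = (\<Sum>i\<in>A. l i * (norm (ip x (e i)))\<^sup>2)"
    and "rip w (x - orthogonal_projection e A x) = 0"
proof -
  let ?p = "orthogonal_projection e A x"
  have w: "ip w z = (\<Sum>i\<in>A. ip x (e i) * (of_real (l i) * ip (e i) z))" for z
    by (simp add: w_def ip_sum_left ip_smul_left ip_scaleR_left)
  have orth: "ip (e i) (x - ?p) = 0" if "i \<in> A" for i
    using ip_diff_projection[OF e that] ip_eq_0_commute by blast
  then show "rip w (x - ?p) = 0"
    by (intro rip_eq_0) (simp add: w)
  have ip_p: "ip (e i) ?p = conj (ip x (e i))" if "i \<in> A" for i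
    using ip_diff_projection[OF e that, of x] ip_conj[of "e i" ?p] by (simp add: ip_diff_left)
  have "ip w ?p = (\<Sum>i\<in>A. of_real (l i * (norm (ip x (e i)))\<^sup>2))"
    unfolding w
  proof (rule sum.cong[OF refl])
    fix i assume "i \<in> A"
    then have "ip x (e i) * (of_real (l i) * ip (e i) ?p) = of_real (l i) * (ip x (e i) * conj (ip x (e i)))"
      by (simp add: ip_p)
    then show "ip x (e i) * (of_real (l i) * ip (e i) ?p) = of_real (l i * (norm (ip x (e i)))\<^sup>2)"
      by (simp add: mult_conj scaleR_conv_of_real)
  qed
  then have *: "ip w ?p = of_real (\<Sum>i\<in>A. l i * (norm (ip x (e i)))\<^sup>2)" by simp
  \<comment> \<open>The value is real and hence fixed by \<open>conj\<close>.\<close>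
  moreover have "ip ?p w = ip w ?p"
    using * by (metis ip_conj conj_of_real)
  ultimately show "rip w ?p = (\<Sum>i\<in>A. l i * (norm (ip x (e i)))\<^sup>2)"
    by (intro rip_eqI) simp
qed

lemma norm_projection:
  assumes e: "orthonormal_or_zero A e" "finite A"
  shows "(norm x)\<^sup>2 = (\<Sum>i\<in>A. (norm (ip x (e i)))\<^sup>2) + (norm (x - orthogonal_projection e A x))\<^sup>2"
proof -
  let ?p = "orthogonal_projection e A x"
  have p: "?p = (\<Sum>i\<in>A. smul (ip x (e i)) (1 *\<^sub>R e i))"
    by (simp add: orthogonal_projection_def)
  have "rip ?p ?p = (\<Sum>i\<in>A. (norm (ip x (e i)))\<^sup>2)" "rip ?p (x - ?p) = 0"
    using ip_weighted_projection[OF e, where l = "\<lambda>_. 1" and x = x]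
    unfolding p[symmetric] by simp_all
  moreover have "rip x x = rip (?p + (x - ?p)) (?p + (x - ?p))" by simp
  ultimately show ?thesis
    unfolding rip_add_left rip_add_right rip_commute[of "x - ?p" ?p] by (simp add: rip_self)
qed

lemma bessel:
  assumes "orthonormal_or_zero A e" "finite A"
  shows "(\<Sum>i\<in>A. (norm (ip x (e i)))\<^sup>2) \<le> (norm x)\<^sup>2"
  using norm_projection[OF assms, of x] by simp

lemma norm_ip_commute: "norm (ip x y) = norm (ip y x)"
  by (metis ip_conj norm_conj)

text \<open>Bessel's inequality for a single vector takes the place of Cauchy-Schwarz for the
  scalar-valued \<open>ip\<close>.\<close>

lemma bounded_linear_ip_left:
  assumes "norm e = 1 \<or> e = 0"
  shows "bounded_linear (\<lambda>x. ip x e)"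
proof (rule bounded_linear_intro[where K = 1])
  fix x
  have "(norm (ip x e))\<^sup>2 \<le> (norm x)\<^sup>2"
    using bessel[of "{()}" "\<lambda>_. e" x] assms by (simp add: orthonormal_or_zero_def)
  then show "norm (ip x e) \<le> norm x * 1" by (simp add: power2_le_iff_abs_le)
qed (simp_all add: ip_add_left ip_scaleR_left scaleR_conv_of_real)

lemma closed_subspace_orthogonal:
  assumes "\<And>i. i \<in> A \<Longrightarrow> norm (e i) = 1 \<or> e i = 0"
  shows "closed {x. \<forall>i\<in>A. ip x (e i) = 0}" "Real_Vector_Spaces.subspace {x. \<forall>i\<in>A. ip x (e i) = 0}"
proof -
  have "closed {x. ip x (e i) = 0}" if "i \<in> A" for i
    by (intro closed_Collect_eq continuous_on_const linear_continuous_on bounded_linear_ip_left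
        assms that)
  then have "closed (\<Inter>i\<in>A. {x. ip x (e i) = 0})" by blast
  also have "(\<Inter>i\<in>A. {x. ip x (e i) = 0}) = {x. \<forall>i\<in>A. ip x (e i) = 0}" by auto
  finally show "closed {x. \<forall>i\<in>A. ip x (e i) = 0}" .
  show "Real_Vector_Spaces.subspace {x. \<forall>i\<in>A. ip x (e i) = 0}"
    by (rule real_vector.subspaceI) (auto simp: ip_add_left ip_scaleR_left)
qed

section \<open>Construction of the positive spectrum\<close>

text \<open>If there are only finitely many positive eigenvalues, both sequences are padded with 0. The last
  conjunct is what makes \<open>e\<close> exhaust every eigenspace of a positive eigenvalue.\<close>

definition positive_spectrum :: "('a \<Rightarrow>\<^sub>L 'a) \<Rightarrow> (nat \<Rightarrow> 'a) \<Rightarrow> (nat \<Rightarrow> real) \<Rightarrow> bool" where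
  "positive_spectrum S e l \<longleftrightarrow> orthonormal_or_zero UNIV e
     \<and> (\<forall>n. blinfun_apply S (e n) = l n *\<^sub>R e n)
     \<and> (\<forall>n. norm (e n) = 1 \<and> l n > 0 \<or> e n = 0 \<and> l n = 0)
     \<and> (\<forall>n x. (\<forall>i<n. ip x (e i) = 0) \<longrightarrow> rip (blinfun_apply S x) x \<le> l n * (norm x)\<^sup>2)"

text \<open>Dependent choice: the orthogonal complement of the vectors found so far is closed and
  invariant, so maximizing the Rayleigh quotient there yields the next pair.\<close>

lemma exists_positive_spectrum:
  assumes S: "S \<in> K1 smul ip"
  shows "\<exists>e l. positive_spectrum S e l"
proof -
  define P where "P f n gM \<longleftrightarrow> (case gM of (g, M) \<Rightarrow> blinfun_apply S g = M *\<^sub>R g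
     \<and> (\<forall>i<n. ip g (fst (f i)) = 0) \<and> (norm g = 1 \<and> M > 0 \<or> g = 0 \<and> M = 0)
     \<and> (\<forall>x. (\<forall>i<n. ip x (fst (f i)) = 0) \<longrightarrow> rip (blinfun_apply S x) x \<le> M * (norm x)\<^sup>2))"
    for f :: "nat \<Rightarrow> 'a \<times> real" and n gM
  have "\<exists>f. \<forall>n. P f n (f n)"
  proof (rule dependent_wellorder_choice)
    show "P f n r = P g n r" if "\<And>m. m < n \<Longrightarrow> f m = g m" for r f g n
      using that by (auto simp: P_def)
  next
    fix n f
    assume P: "\<And>m. m < n \<Longrightarrow> P f m (f m)"
    let ?e = "\<lambda>i. fst (f i)"
    let ?V = "{x. \<forall>i\<in>{..<n}. ip x (?e i) = 0}"
    have unit: "norm (?e i) = 1 \<or> ?e i = 0" and eig: "blinfun_apply S (?e i) = snd (f i) *\<^sub>R ?e i"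
      if "i \<in> {..<n}" for i
      using P[of i] that by (auto simp: P_def case_prod_beta)
    \<comment> \<open>Selfadjointness moves \<open>S\<close> onto \<open>?e i\<close>, which is an
      eigenvector.\<close>
    have "blinfun_apply S x \<in> ?V" if "x \<in> ?V" for x
      using that eig by (auto simp: K1_ip[OF S] ip_scaleR_right)
    from exists_maximizing_eigenvector[OF S closed_subspace_orthogonal(2,1)[OF unit] this]
    obtain g M where "g \<in> ?V" "blinfun_apply S g = M *\<^sub>R g" "norm g = 1 \<and> M > 0 \<or> g = 0 \<and> M = 0"
        "\<forall>x\<in>?V. rip (blinfun_apply S x) x \<le> M * (norm x)\<^sup>2"
      by blast
    then have "P f n (g, M)" by (simp add: P_def)
    then show "\<exists>r. P f n r" by blast
  qed
  then obtain f where f: "\<And>n. P f n (f n)" by blast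
  have "ip (fst (f i)) (fst (f j)) = 0" if "i \<noteq> j" for i j
    using f[of i] f[of j] that ip_eq_0_commute
    by (cases i j rule: linorder_cases) (auto simp: P_def case_prod_beta)
  then have "positive_spectrum S (\<lambda>n. fst (f n)) (\<lambda>n. snd (f n))"
    using f by (auto simp: positive_spectrum_def orthonormal_or_zero_def P_def case_prod_beta)
  then show ?thesis by blast
qed

text \<open>This distance excludes Cauchy subsequences and makes unit vectors of the system
  distinct.\<close>

lemma orthonormal_norm_diff:
  assumes "orthonormal_or_zero A e" "i \<in> A" "j \<in> A" "i \<noteq> j" "norm (e i) = 1" "norm (e j) = 1"
  shows "(norm (e i - e j))\<^sup>2 = 2"
proof -
  have "rip (e i) (e j) = 0" "rip (e j) (e i) = 0"
    using assms by (auto simp: orthonormal_or_zero_def intro: rip_eq_0)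
  then show ?thesis
    using assms by (simp add: rip_self[symmetric] rip_diff_left rip_diff_right) (simp add: rip_self)
qed

section \<open>Decay, multiplicities and Ky Fan's inequality for a positive spectrum\<close>

context
  fixes S e l
  assumes S: "S \<in> K1 smul ip" and spec: "positive_spectrum S e l"
begin

lemma spectrum_orthonormal: "orthonormal_or_zero A e"
  using spec orthonormal_or_zero_subset by (auto simp: positive_spectrum_def)

lemma spectrum_eigenvector: "blinfun_apply S (e n) = l n *\<^sub>R e n"
  using spec by (auto simp: positive_spectrum_def)

lemma spectrum_norm: "norm (e n) = 1 \<and> l n > 0 \<or> e n = 0 \<and> l n = 0"
  using spec by (auto simp: positive_spectrum_def)

lemma spectrum_rip_le: "(\<And>i. i < n \<Longrightarrow> ip x (e i) = 0) \<Longrightarrow> rip (blinfun_apply S x) x \<le> l n * (norm x)\<^sup>2"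
  using spec by (auto simp: positive_spectrum_def)

lemma spectrum_nonneg: "0 \<le> l n"
  using spectrum_norm[of n] by auto

lemma spectrum_rip: "rip (blinfun_apply S (e n)) (e n) = l n"
  using spectrum_norm[of n] by (auto simp: spectrum_eigenvector rip_scaleR_left rip_self)

lemma spectrum_le_norm: "l n \<le> norm S"
  using rip_blinfun_le[of S "e n"] spectrum_norm[of n] by (auto simp: spectrum_rip)

text \<open>The vector \<open>e (Suc n)\<close> already competes in the maximization at stage
  n.\<close>

lemma spectrum_decseq: "decseq l"
proof (rule decseq_SucI)
  fix n
  have "ip (e (Suc n)) (e i) = 0" if "i < n" for i
    using spectrum_orthonormal[of UNIV] that by (auto simp: orthonormal_or_zero_def)
  from spectrum_rip_le[of n, OF this] show "l (Suc n) \<le> l n"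
    using spectrum_norm[of "Suc n"] spectrum_nonneg[of n] by (auto simp: spectrum_rip)
qed

text \<open>Otherwise the vectors \<open>e n\<close> divided by \<open>l n\<close> are bounded and
  \<open>S\<close> maps them to \<open>e n\<close>; compactness would give a convergent subsequence
  of an orthonormal sequence.\<close>

lemma exists_spectrum_less:
  assumes "0 < c"
  shows "\<exists>n. l n < c"
proof (rule ccontr)
  assume "\<nexists>n. l n < c"
  then have ge: "c \<le> l n" for n by (simp add: not_less)
  then have pos: "0 < l n" for n using assms less_le_trans by blast
  then have unit: "norm (e n) = 1" for n using spectrum_norm[of n] by (metis less_irrefl)
  have "norm (inverse (l n) *\<^sub>R e n) \<le> inverse c" for n
    using ge[of n] pos[of n] assms by (simp add: unit le_imp_inverse_le)
  from K1_convergent_subseq[OF S, of "\<lambda>n. inverse (l n) *\<^sub>R e n", OF this]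
  obtain z r where r: "strict_mono (r :: nat \<Rightarrow> nat)"
      and "(\<lambda>n. blinfun_apply S (inverse (l (r n)) *\<^sub>R e (r n))) \<longlonglongrightarrow> z"
    by blast
  then have "(\<lambda>n. e (r n)) \<longlonglongrightarrow> z"
    using pos by (simp add: blinfun.scaleR_right spectrum_eigenvector less_imp_neq[symmetric] del: inverse_eq_divide)
  then have "Cauchy (\<lambda>n. e (r n))" by (rule LIMSEQ_imp_Cauchy)
  then obtain N where N: "\<And>m n. m \<ge> N \<Longrightarrow> n \<ge> N \<Longrightarrow> norm (e (r m) - e (r n)) < 1"
    by (meson CauchyD zero_less_one)
  have "r N \<noteq> r (Suc N)" using r by (simp add: strict_mono_eq)
  then have "(norm (e (r N) - e (r (Suc N))))\<^sup>2 = 2"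
    using orthonormal_norm_diff[OF spectrum_orthonormal[of UNIV]] unit by blast
  moreover have "(norm (e (r N) - e (r (Suc N))))\<^sup>2 \<le> 1\<^sup>2"
    using N[of N "Suc N"] by (intro power_mono) auto
  ultimately show False by simp
qed

lemma spectrum_finite_level:
  assumes "0 < r"
  shows "finite {n. l n = r}"
proof -
  obtain n where "l n < r" using exists_spectrum_less assms by blast
  then have "m < n" if "l m = r" for m
    using decseqD[OF spectrum_decseq, of n m] that by (cases "m < n") auto
  then show ?thesis by (auto intro: bounded_nat_set_is_finite)
qed

text \<open>The vectors \<open>e n\<close> with \<open>l n = r\<close> form a basis of the
  eigenspace. Orthogonality gives independence; they span because an eigenvector minus its
  projection onto them is orthogonal to every \<open>e n\<close>, which forces it to vanish.\<close>

lemma spectrum_card_level: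
  assumes "0 < r"
  shows "card {n. l n = r} = dim (eigenspace smul S r)"
proof -
  let ?A = "{n. l n = r}"
  note fin = spectrum_finite_level[OF assms]
  have unit: "norm (e n) = 1" if "n \<in> ?A" for n
    using spectrum_norm[of n] that assms by auto
  have inj: "inj_on e ?A"
  proof (rule inj_onI, rule ccontr)
    fix i j assume "i \<in> ?A" "j \<in> ?A" "e i = e j" "i \<noteq> j"
    then show False using orthonormal_norm_diff[OF spectrum_orthonormal[of UNIV], of i j] unit by simp
  qed
  have "dim (eigenspace smul S r) = card (e ` ?A)"
  proof (rule dim_unique[OF _ _ _ refl])
    show "e ` ?A \<subseteq> eigenspace smul S r"
      by (auto simp: eigenspace_def spectrum_eigenvector smul_of_real)
    show "independent (e ` ?A)"
    proof (rule independent_if_scalars_zero)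
      fix c x assume 0: "(\<Sum>v\<in>e ` ?A. smul (c v) v) = 0" and "x \<in> e ` ?A"
      then obtain i where i: "i \<in> ?A" "x = e i" by blast
      have "(\<Sum>j\<in>?A. smul (c (e j)) (e j)) = 0"
        using 0 by (simp add: sum.reindex[OF inj])
      then have "c (e i) * ip (e i) (e i) = 0"
        using ip_orthonormal_sum[OF spectrum_orthonormal fin i(1), of "\<lambda>j. c (e j)"] by simp
      then show "c x = 0" using unit[OF i(1)] i by (simp add: ip_self)
    qed (use fin in simp)
    show "eigenspace smul S r \<subseteq> span (e ` ?A)"
    proof
      fix x assume "x \<in> eigenspace smul S r"
      then have Sx: "blinfun_apply S x = r *\<^sub>R x" by (simp add: eigenspace_def smul_of_real)
      let ?p = "orthogonal_projection e ?A x"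
      let ?y = "x - ?p"
      have "blinfun_apply S ?p = (\<Sum>i\<in>?A. smul (ip x (e i)) (r *\<^sub>R e i))"
        by (simp add: orthogonal_projection_def blinfun.sum_right K1_smul[OF S] spectrum_eigenvector)
      also have "\<dots> = r *\<^sub>R ?p"
        by (simp add: orthogonal_projection_def scale_sum_right mult.commute flip: smul_of_real)
      finally have Sy: "blinfun_apply S ?y = r *\<^sub>R ?y"
        by (simp add: blinfun.diff_right Sx algebra_simps)
      have y_orth: "ip ?y (e n) = 0" for n
      proof (cases "l n = r")
        case True
        then show ?thesis using ip_diff_projection[OF spectrum_orthonormal fin] by simp
      next
        case False
        have "of_real r * ip ?y (e n) = ip (blinfun_apply S ?y) (e n)"
          by (simp only: Sy ip_scaleR_left)
        also have "\<dots> = of_real (l n) * ip ?y (e n)"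
          by (simp only: K1_ip[OF S] spectrum_eigenvector ip_scaleR_right)
        finally show ?thesis using False by simp
      qed
      \<comment> \<open>The form at \<open>?y\<close> is r times its squared norm, yet at most
        \<open>l n\<close> times it for this n.\<close>
      obtain n where n: "l n < r" using exists_spectrum_less assms by blast
      have "r * (norm ?y)\<^sup>2 \<le> l n * (norm ?y)\<^sup>2"
        using spectrum_rip_le[of n ?y] y_orth by (simp only: Sy rip_scaleR_left rip_self)
      then have "?y = 0" using n by (simp add: mult_le_cancel_right)
      then have "x = ?p" by simp
      also have "\<dots> \<in> span (e ` ?A)"
        unfolding orthogonal_projection_def by (intro span_sum span_scale span_base) auto
      finally show "x \<in> span (e ` ?A)" .
    qed
  qed
  then show ?thesis by (simp add: card_image[OF inj])
qed

text \<open>Split x into its projection onto the first k eigenvectors and a remainder, on which the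
  form is bounded by \<open>l k\<close>. Eliminating the remainder by Pythagoras leaves the weights
  \<open>l i - l k\<close>, nonnegative and therefore ready for Bessel.\<close>

lemma spectrum_rip_le_weighted_sum:
  "rip (blinfun_apply S x) x \<le> (\<Sum>i<k. (l i - l k) * (norm (ip x (e i)))\<^sup>2) + l k * (norm x)\<^sup>2"
proof -
  let ?p = "orthogonal_projection e {..<k} x"
  let ?y = "x - ?p"
  note proj = ip_weighted_projection[where A = "{..<k}" and e = e and x = x and l = l, OF spectrum_orthonormal finite_lessThan]
  have Sp: "blinfun_apply S ?p = (\<Sum>i<k. smul (ip x (e i)) (l i *\<^sub>R e i))"
    by (simp add: orthogonal_projection_def blinfun.sum_right K1_smul[OF S] spectrum_eigenvector)
  have "rip (blinfun_apply S x) x = rip (blinfun_apply S (?p + ?y)) (?p + ?y)" by simp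
  also have "\<dots> = rip (blinfun_apply S ?p) ?p + 2 * rip (blinfun_apply S ?p) ?y
      + rip (blinfun_apply S ?y) ?y"
    unfolding blinfun.add_right rip_add_left rip_add_right
    using K1_rip[OF S, of ?y ?p] rip_commute[of ?y] by simp
  also have "\<dots> = (\<Sum>i<k. l i * (norm (ip x (e i)))\<^sup>2) + rip (blinfun_apply S ?y) ?y"
    unfolding Sp proj by simp
  also have "\<dots> \<le> (\<Sum>i<k. l i * (norm (ip x (e i)))\<^sup>2) + l k * (norm ?y)\<^sup>2"
    using ip_diff_projection[OF spectrum_orthonormal finite_lessThan[of k]] by (intro add_left_mono spectrum_rip_le) auto
  also have "(norm ?y)\<^sup>2 = (norm x)\<^sup>2 - (\<Sum>i<k. (norm (ip x (e i)))\<^sup>2)"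
    using norm_projection[OF spectrum_orthonormal finite_lessThan, of x k] by simp
  finally show ?thesis
    by (simp add: sum_subtractf left_diff_distrib right_diff_distrib sum_distrib_left)
qed

text \<open>Sum the previous bound over j and exchange the sums. By Bessel for the system
  \<open>g\<close> at the vector \<open>e i\<close>, each \<open>l i - l k\<close> gets a factor at
  most 1; the k copies of \<open>l k\<close> then restore the sum of the \<open>l i\<close>.\<close>

lemma spectrum_ky_fan:
  assumes g: "orthonormal_or_zero {..<k} g"
  shows "(\<Sum>j<k. rip (blinfun_apply S (g j)) (g j)) \<le> (\<Sum>i<k. l i)"
proof -
  have g_le: "(norm (g j))\<^sup>2 \<le> 1" if "j < k" for j
  proof -
    have "norm (g j) = 1 \<or> g j = 0" using g that by (simp add: orthonormal_or_zero_def)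
    then show ?thesis by auto
  qed
  have e_le: "(norm (e i))\<^sup>2 \<le> 1" for i
    using spectrum_norm[of i] by auto
  have "(\<Sum>j<k. rip (blinfun_apply S (g j)) (g j))
      \<le> (\<Sum>j<k. (\<Sum>i<k. (l i - l k) * (norm (ip (g j) (e i)))\<^sup>2) + l k * (norm (g j))\<^sup>2)"
    by (intro sum_mono spectrum_rip_le_weighted_sum)
  also have "\<dots> = (\<Sum>i<k. (l i - l k) * (\<Sum>j<k. (norm (ip (e i) (g j)))\<^sup>2)) + (\<Sum>j<k. l k * (norm (g j))\<^sup>2)"
    by (simp add: sum.distrib sum_distrib_left norm_ip_commute[of "g _"])
      (rule sum.swap)
  also have "\<dots> \<le> (\<Sum>i<k. (l i - l k) * 1) + (\<Sum>j<k. l k * 1)"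
    using bessel[OF g finite_lessThan] e_le g_le spectrum_nonneg decseqD[OF spectrum_decseq]
    by (intro add_mono sum_mono mult_left_mono) (auto intro: order_trans)
  also have "\<dots> = (\<Sum>i<k. l i)" by (simp add: sum_subtractf)
  finally show ?thesis .
qed

end

subsection \<open>Arrangement of the eigenvalues\<close>

lemma smul_scaleR: "smul c (r *\<^sub>R x) = r *\<^sub>R smul c x"
  by (simp add: mult.commute flip: smul_of_real)

lemma K1_add: "S \<in> K1 smul ip \<Longrightarrow> T \<in> K1 smul ip \<Longrightarrow> S + T \<in> K1 smul ip"
  by (auto simp: K1_def Vector_Spaces.linear_iff blinfun.add_left ip_add_left ip_add_right
      scale_right_distrib algebra_simps compact_operator_add plus_blinfun.rep_eq)

lemma K1_scaleR: "S \<in> K1 smul ip \<Longrightarrow> r *\<^sub>R S \<in> K1 smul ip"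
  by (auto simp: K1_def Vector_Spaces.linear_iff blinfun.scaleR_left ip_scaleR_left ip_scaleR_right
      scaleR_add_right smul_scaleR compact_operator_scaleR scaleR_blinfun.rep_eq)

lemma K1_uminus: "S \<in> K1 smul ip \<Longrightarrow> - S \<in> K1 smul ip"
  using K1_scaleR[of S "-1"] by simp

lemma eigenspace_uminus: "eigenspace smul (- S) (- r) = eigenspace smul S r"
  by (simp only: eigenspace_def smul_of_real blinfun.minus_left scaleR_minus_left neg_equal_iff_equal)

text \<open>Values at indices \<le> 0 are nonpositive, so a positive level is attained only at
  positive indices and the shift by 1 preserves its size.\<close>

lemma arrangement_positive_part:
  assumes "eigenvalue_arrangement smul S lam"
  defines "a \<equiv> \<lambda>k. lam (int k + 1)"
  shows "decseq a" "0 \<le> a k"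
    and "0 < r \<Longrightarrow> finite {k. a k = r}"
    and "0 < r \<Longrightarrow> card {k. a k = r} = dim (eigenspace smul S r)"
proof -
  have nonpos: "lam n \<le> 0" if "n \<le> 0" for n
    using assms(1) that by (cases "n = 0") (auto simp: eigenvalue_arrangement_def dest!: spec[of _ "- n"])
  show "decseq a"
    unfolding a_def using assms(1)
    by (intro decseq_SucI) (auto simp: eigenvalue_arrangement_def add.commute dest!: spec[of _ "int _ + 1"])
  show "0 \<le> a k"
    using assms(1) by (auto simp: eigenvalue_arrangement_def a_def)
  have bij: "bij_betw (\<lambda>k. int k + 1) {k. a k = r} {n. lam n = r}" if "0 < r" for r
  proof (rule bij_betw_byWitness[where f' = "\<lambda>n. nat (n - 1)"])
    have "0 < n" if "lam n = r" for n
      using nonpos[of n] that \<open>0 < r\<close> by (cases "n \<le> 0") auto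
    then show "\<forall>n\<in>{n. lam n = r}. int (nat (n - 1)) + 1 = n"
      and "(\<lambda>n. nat (n - 1)) ` {n. lam n = r} \<subseteq> {k. a k = r}"
      by (force simp: a_def)+
  qed (auto simp: a_def)
  show "0 < r \<Longrightarrow> finite {k. a k = r}"
    and "0 < r \<Longrightarrow> card {k. a k = r} = dim (eigenspace smul S r)"
    using bij_betw_finite[OF bij] bij_betw_same_card[OF bij] assms(1)
    by (auto simp: eigenvalue_arrangement_def)
qed

text \<open>Reflecting the indices reduces statements about negative eigenvalues to positive
  ones.\<close>

lemma arrangement_uminus:
  assumes "eigenvalue_arrangement smul S lam"
  shows "eigenvalue_arrangement smul (- S) (\<lambda>n. - lam (- n))"
proof -
  have level: "finite {n. - lam (- n) = r} \<and>
      card {n. - lam (- n) = r} = dim (eigenspace smul (- S) r)" if "r \<noteq> 0" for r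
  proof -
    have "bij_betw uminus {n. - lam (- n) = r} {n. lam n = - r}"
      by (rule bij_betw_byWitness[where f' = uminus]) auto
    moreover have "finite {n. lam n = - r} \<and> card {n. lam n = - r} = dim (eigenspace smul S (- r))"
      using assms that unfolding eigenvalue_arrangement_def by (metis neg_equal_0_iff_equal)
    ultimately show ?thesis
      using eigenspace_uminus[of S "- r"] bij_betw_finite bij_betw_same_card by fastforce
  qed
  show ?thesis
    unfolding eigenvalue_arrangement_def
  proof (intro conjI)
    show "\<forall>r. r \<noteq> 0 \<longrightarrow> finite {n. - lam (- n) = r} \<and>
        card {n. - lam (- n) = r} = dim (eigenspace smul (- S) r)"
      using level by blast
  qed (use assms in \<open>auto simp: eigenvalue_arrangement_def add.commute[of 1]\<close>)
qed

text \<open>The level sizes determine the positive half; reflection handles the negative half. With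
  existence, this gives meaning to the definite description in \<open>eigval\<close>.\<close>

lemma arrangement_unique:
  assumes "eigenvalue_arrangement smul S lam" "eigenvalue_arrangement smul S lam'"
  shows "lam = lam'"
proof
  have positive: "lam (int k + 1) = lam' (int k + 1)"
    if "eigenvalue_arrangement smul S lam" "eigenvalue_arrangement smul S lam'" for S lam lam' k
    using decseq_eq_if_level_cards_eq[OF arrangement_positive_part(1)[OF that(1)]
        arrangement_positive_part(1)[OF that(2)] arrangement_positive_part(2)[OF that(1)]
        arrangement_positive_part(2)[OF that(2)] arrangement_positive_part(3)[OF that(1)]
        arrangement_positive_part(3)[OF that(2)]]
      arrangement_positive_part(4)[OF that(1)] arrangement_positive_part(4)[OF that(2)]
    by (simp add: fun_eq_iff)
  fix n :: int
  consider "n = 0" | "n > 0" | "n < 0" by linarith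
  then show "lam n = lam' n"
  proof cases
    case 1
    then show ?thesis using assms by (simp add: eigenvalue_arrangement_def)
  next
    case 2
    then show ?thesis using positive[OF assms, of "nat (n - 1)"] by simp
  next
    case 3
    then show ?thesis
      using positive[OF assms[THEN arrangement_uminus], of "nat (- n - 1)"] by simp
  qed
qed

lemma exists_arrangement:
  assumes S: "S \<in> K1 smul ip"
  shows "\<exists>lam. eigenvalue_arrangement smul S lam"
proof -
  obtain e l where l: "positive_spectrum S e l"
    using exists_positive_spectrum[OF S] by blast
  obtain e' l' where l': "positive_spectrum (- S) e' l'"
    using exists_positive_spectrum[OF K1_uminus[OF S]] by blast
  \<comment> \<open>The positive half comes from the spectrum of \<open>S\<close>, the negative half
    from that of \<open>- S\<close> with the sign reversed.\<close>
  define lam where "lam n =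
    (if n > 0 then l (nat (n - 1)) else if n < 0 then - l' (nat (- n - 1)) else 0)" for n :: int
  note nonneg = spectrum_nonneg[OF S l] spectrum_nonneg[OF K1_uminus[OF S] l']
  have "lam (i + 1) \<le> lam i \<and> 0 \<le> lam i \<and> lam (- i) \<le> lam (- i - 1) \<and> lam (- i) \<le> 0" if "1 \<le> i" for i
    using decseqD[OF spectrum_decseq[OF S l], of "nat (i - 1)" "nat i"]
      decseqD[OF spectrum_decseq[OF K1_uminus[OF S] l'], of "nat (i - 1)" "nat i"] nonneg that
    by (simp add: lam_def)
  moreover have "finite {n. lam n = r} \<and> card {n. lam n = r} = dim (eigenspace smul S r)"
    if "r \<noteq> 0" for r
  proof (cases "r > 0")
    case True
    have "0 < n" if "lam n = r" for n
      using that True nonneg by (auto simp: lam_def split: if_splits) (smt (verit))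
    then have "bij_betw (\<lambda>k. int k + 1) {k. l k = r} {n. lam n = r}"
      by (intro bij_betw_byWitness[where f' = "\<lambda>n. nat (n - 1)"]) (force simp: lam_def)+
    then show ?thesis
      using spectrum_finite_level[OF S l True] spectrum_card_level[OF S l True] bij_betw_finite bij_betw_same_card
      by fastforce
  next
    case False
    with that have r: "0 < - r" by simp
    have "n < 0" if "lam n = r" for n
      using that r nonneg by (auto simp: lam_def split: if_splits) (smt (verit))
    then have "bij_betw (\<lambda>k. - int k - 1) {k. l' k = - r} {n. lam n = r}"
      by (intro bij_betw_byWitness[where f' = "\<lambda>n. nat (- n - 1)"]) (force simp: lam_def)+
    then show ?thesis
      using spectrum_finite_level[OF K1_uminus[OF S] l' r] spectrum_card_level[OF K1_uminus[OF S] l' r]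
        bij_betw_finite bij_betw_same_card eigenspace_uminus
      by fastforce
  qed
  ultimately have "eigenvalue_arrangement smul S lam"
    by (simp add: eigenvalue_arrangement_def) (simp add: lam_def)
  then show ?thesis by blast
qed

lemma eigval_arrangement:
  "S \<in> K1 smul ip \<Longrightarrow> eigenvalue_arrangement smul S (eigval smul S)"
  unfolding eigval_def using exists_arrangement arrangement_unique by (metis theI)

lemma eigval_0: "S \<in> K1 smul ip \<Longrightarrow> eigval smul S 0 = 0"
  using eigval_arrangement by (auto simp: eigenvalue_arrangement_def)

lemma eigval_uminus: "S \<in> K1 smul ip \<Longrightarrow> eigval smul (- S) n = - eigval smul S (- n)"
  using arrangement_unique[OF eigval_arrangement[OF K1_uminus]
      arrangement_uminus[OF eigval_arrangement]] by metis

text \<open>Both sequences are nonincreasing and nonnegative, and their positive levels have the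
  eigenspace dimensions as sizes.\<close>

lemma eigval_positive_spectrum:
  assumes S: "S \<in> K1 smul ip" and l: "positive_spectrum S e l"
  shows "eigval smul S (int k + 1) = l k"
proof -
  note part = arrangement_positive_part[OF eigval_arrangement[OF S]]
  have "(\<lambda>k. eigval smul S (int k + 1)) = l"
    by (rule decseq_eq_if_level_cards_eq)
      (simp_all add: part spectrum_nonneg[OF S l] spectrum_decseq[OF S l] spectrum_finite_level[OF S l] spectrum_card_level[OF S l])
  then show ?thesis by metis
qed

lemma abs_eigval_le:
  assumes S: "S \<in> K1 smul ip"
  shows "\<bar>eigval smul S n\<bar> \<le> norm S"
proof -
  have positive: "\<bar>eigval smul S (int k + 1)\<bar> \<le> norm S" if "S \<in> K1 smul ip" for S k
    using exists_positive_spectrum[OF that] eigval_positive_spectrum[OF that] spectrum_nonneg[OF that]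
      spectrum_le_norm[OF that] by (metis abs_of_nonneg)
  consider "n = 0" | "n > 0" | "n < 0" by linarith
  then show ?thesis
  proof cases
    case 1
    then show ?thesis by (simp add: eigval_0[OF S])
  next
    case 2
    then show ?thesis using positive[OF S, of "nat (n - 1)"] by simp
  next
    case 3
    then show ?thesis
      using positive[OF K1_uminus[OF S], of "nat (- n - 1)"] eigval_uminus[OF S, of "- n"] by simp
  qed
qed

subsection \<open>Convexity and Lipschitz continuity\<close>

lemma ky_fan_eigval:
  assumes S: "S \<in> K1 smul ip" and "orthonormal_or_zero {..<k} g"
  shows "(\<Sum>j<k. rip (blinfun_apply S (g j)) (g j)) \<le> (\<Sum>i<k. eigval smul S (int i + 1))"
  using exists_positive_spectrum[OF S] spectrum_ky_fan[OF S _ assms(2)] eigval_positive_spectrum[OF S] by auto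

text \<open>The eigenvectors attain equality in Ky Fan's inequality, and the same sequence does so
  for every k.\<close>

lemma ky_fan_eigval_attained:
  assumes S: "S \<in> K1 smul ip"
  shows "\<exists>g. (\<forall>A. orthonormal_or_zero A g) \<and> (\<forall>j. norm (g j) \<le> 1
    \<and> eigval smul S (int j + 1) = rip (blinfun_apply S (g j)) (g j))"
proof -
  obtain e l where l: "positive_spectrum S e l"
    using exists_positive_spectrum[OF S] by blast
  have "norm (e j) \<le> 1" for j
    using spectrum_norm[OF S l, of j] by auto
  then show ?thesis
    using spectrum_orthonormal[OF S l] by (intro exI[of _ e]) (simp add: spectrum_rip[OF S l] eigval_positive_spectrum[OF S l])
qed

text \<open>Take the maximizing system of the combination; it is only a competitor for
  \<open>S\<close> and for \<open>T\<close>.\<close>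

lemma sum_eigval_convex:
  assumes S: "S \<in> K1 smul ip" and T: "T \<in> K1 smul ip" and "0 \<le> u" "0 \<le> v"
  shows "(\<Sum>i<k. eigval smul (u *\<^sub>R S + v *\<^sub>R T) (int i + 1))
    \<le> (\<Sum>i<k. u * eigval smul S (int i + 1) + v * eigval smul T (int i + 1))"
proof -
  have "u *\<^sub>R S + v *\<^sub>R T \<in> K1 smul ip"
    by (intro K1_add K1_scaleR S T)
  then obtain g where g: "\<And>A. orthonormal_or_zero A g" "\<And>j. norm (g j) \<le> 1"
      "\<And>j. eigval smul (u *\<^sub>R S + v *\<^sub>R T) (int j + 1)
        = rip (blinfun_apply (u *\<^sub>R S + v *\<^sub>R T) (g j)) (g j)"
    using ky_fan_eigval_attained by meson
  have "(\<Sum>i<k. eigval smul (u *\<^sub>R S + v *\<^sub>R T) (int i + 1))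
      = u * (\<Sum>i<k. rip (blinfun_apply S (g i)) (g i)) + v * (\<Sum>i<k. rip (blinfun_apply T (g i)) (g i))"
    by (simp add: g(3) blinfun.add_left blinfun.scaleR_left rip_add_left rip_scaleR_left
        sum.distrib sum_distrib_left)
  also have "\<dots> \<le> u * (\<Sum>i<k. eigval smul S (int i + 1)) + v * (\<Sum>i<k. eigval smul T (int i + 1))"
    by (intro add_mono mult_left_mono ky_fan_eigval S T g(1) assms)
  finally show ?thesis by (simp add: sum.distrib sum_distrib_left)
qed

text \<open>The maximizing system of \<open>S\<close> competes for \<open>T\<close>, and each vector
  costs at most \<open>norm (S - T)\<close>. The norm stands inside the sum so that
  \<open>weighted_suminf_mono\<close> applies termwise.\<close>

lemma sum_eigval_lipschitz:
  assumes S: "S \<in> K1 smul ip" and T: "T \<in> K1 smul ip"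
  shows "(\<Sum>i<k. eigval smul S (int i + 1)) \<le> (\<Sum>i<k. eigval smul T (int i + 1) + norm (S - T))"
proof -
  obtain g where g: "\<And>A. orthonormal_or_zero A g" "\<And>j. norm (g j) \<le> 1"
      "\<And>j. eigval smul S (int j + 1) = rip (blinfun_apply S (g j)) (g j)"
    using ky_fan_eigval_attained[OF S] by meson
  have diff: "rip (blinfun_apply (S - T) (g j)) (g j) \<le> norm (S - T)" for j
    using rip_blinfun_le[of "S - T" "g j"] g(2)[of j] mult_left_le[of "(norm (g j))\<^sup>2" "norm (S - T)"]
    by (simp add: power_le_one)
  have "rip (blinfun_apply S (g j)) (g j)
      = rip (blinfun_apply T (g j)) (g j) + rip (blinfun_apply (S - T) (g j)) (g j)" for j
    by (simp add: blinfun.diff_left rip_diff_left)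
  then have "(\<Sum>i<k. eigval smul S (int i + 1))
      \<le> (\<Sum>i<k. rip (blinfun_apply T (g i)) (g i)) + (\<Sum>i<k. norm (S - T))"
    unfolding g(3) sum.distrib[symmetric] by (intro sum_mono) (simp add: diff)
  also have "\<dots> \<le> (\<Sum>i<k. eigval smul T (int i + 1)) + (\<Sum>i<k. norm (S - T))"
    by (intro add_right_mono ky_fan_eigval T g(1))
  finally show ?thesis by (simp add: sum.distrib)
qed

section \<open>Weighted sums of the positive eigenvalues\<close>

definition positive_functional :: "(nat \<Rightarrow> real) \<Rightarrow> ('a \<Rightarrow>\<^sub>L 'a) \<Rightarrow> real" where
  "positive_functional \<mu> S = (\<Sum>k. \<mu> k * eigval smul S (int k + 1))"

context
  fixes \<mu> :: "nat \<Rightarrow> real"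
  assumes dec: "\<And>i. \<mu> (Suc i) \<le> \<mu> i" and summable: "summable \<mu>"
begin

text \<open>A nonincreasing sequence stays above its limit, which is 0 by summability.\<close>

lemma weight_nonneg: "0 \<le> \<mu> i"
  using decseq_ge[OF decseq_SucI[of \<mu>, OF dec] summable_LIMSEQ_zero[OF summable]] .

lemma summable_weighted_eigval:
  assumes S: "S \<in> K1 smul ip"
  shows "summable (\<lambda>k. \<mu> k * eigval smul S (int k + 1))"
proof (rule summable_comparison_test'[of "\<lambda>k. \<mu> k * norm S" 0])
  show "norm (\<mu> k * eigval smul S (int k + 1)) \<le> \<mu> k * norm S" for k
    using abs_eigval_le[OF S] weight_nonneg[of k] by (simp add: abs_mult mult_left_mono)
qed (intro summable_mult2 summable)

lemma positive_functional_convex: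
  assumes S: "S \<in> K1 smul ip" and T: "T \<in> K1 smul ip" and "0 \<le> u" "0 \<le> v"
  shows "positive_functional \<mu> (u *\<^sub>R S + v *\<^sub>R T)
    \<le> u * positive_functional \<mu> S + v * positive_functional \<mu> T"
proof -
  let ?s = "\<lambda>S k. \<mu> k * eigval smul S (int k + 1)"
  have sums: "(\<lambda>k. u * ?s S k + v * ?s T k) sums (u * suminf (?s S) + v * suminf (?s T))"
    by (intro sums_add sums_mult summable_sums summable_weighted_eigval S T)
  have eq: "(\<lambda>k. u * ?s S k + v * ?s T k)
      = (\<lambda>k. \<mu> k * (u * eigval smul S (int k + 1) + v * eigval smul T (int k + 1)))"
    by (simp add: fun_eq_iff algebra_simps)
  have "positive_functional \<mu> (u *\<^sub>R S + v *\<^sub>R T)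
      \<le> (\<Sum>k. \<mu> k * (u * eigval smul S (int k + 1) + v * eigval smul T (int k + 1)))"
    unfolding positive_functional_def
    by (rule weighted_suminf_mono[OF dec weight_nonneg sum_eigval_convex[OF assms]
        summable_weighted_eigval[OF K1_add[OF K1_scaleR[OF S] K1_scaleR[OF T]]]
        sums_summable[OF sums[unfolded eq]]])
  also have "\<dots> = u * positive_functional \<mu> S + v * positive_functional \<mu> T"
    unfolding positive_functional_def using sums_unique[OF sums] eq by simp
  finally show ?thesis .
qed

lemma positive_functional_lipschitz:
  assumes S: "S \<in> K1 smul ip" and T: "T \<in> K1 smul ip"
  shows "\<bar>positive_functional \<mu> S - positive_functional \<mu> T\<bar> \<le> suminf \<mu> * norm (S - T)"
proof -
  have one_sided: "positive_functional \<mu> S \<le> positive_functional \<mu> T + suminf \<mu> * norm (S - T)"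
    if S: "S \<in> K1 smul ip" and T: "T \<in> K1 smul ip" for S T
  proof -
    let ?s = "\<lambda>k. \<mu> k * eigval smul T (int k + 1)"
    have sums: "(\<lambda>k. ?s k + \<mu> k * norm (S - T)) sums (suminf ?s + suminf \<mu> * norm (S - T))"
      by (intro sums_add sums_mult2 summable_sums summable_weighted_eigval T summable)
    have eq: "(\<lambda>k. ?s k + \<mu> k * norm (S - T))
        = (\<lambda>k. \<mu> k * (eigval smul T (int k + 1) + norm (S - T)))"
      by (simp add: fun_eq_iff algebra_simps)
    have "positive_functional \<mu> S \<le> (\<Sum>k. \<mu> k * (eigval smul T (int k + 1) + norm (S - T)))"
      unfolding positive_functional_def
      by (rule weighted_suminf_mono[OF dec weight_nonneg sum_eigval_lipschitz[OF S T]
          summable_weighted_eigval[OF S] sums_summable[OF sums[unfolded eq]]])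
    also have "\<dots> = positive_functional \<mu> T + suminf \<mu> * norm (S - T)"
      unfolding positive_functional_def using sums_unique[OF sums] eq by simp
    finally show ?thesis .
  qed
  show ?thesis
    using one_sided[OF S T] one_sided[OF T S] by (simp add: abs_le_iff norm_minus_commute)
qed

end

end

section \<open>Combination of the positive and negative halves of the spectrum\<close>

theorem theorem2p1:
  fixes smul :: "'k::real_or_complex \<Rightarrow> 'a::banach \<Rightarrow> 'a"
    and ip :: "'a \<Rightarrow> 'a \<Rightarrow> 'k"
    and \<mu> :: "int \<Rightarrow> real"
  assumes "hilbert_space smul ip"
    and "infinite_dimensional smul"
    and "separable_space (euclidean :: 'a topology)"
    and "\<And>i. i \<ge> 1 \<Longrightarrow> \<mu> i \<ge> \<mu> (i + 1)"
    and "\<And>i. i \<ge> 1 \<Longrightarrow> \<mu> (- i - 1) \<ge> \<mu> (- i)"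
    and "\<And>i j. i \<ge> 1 \<Longrightarrow> j \<ge> 1 \<Longrightarrow> \<mu> i \<ge> \<mu> (- j)"
    and "(\<lambda>n. \<bar>\<mu> n\<bar>) summable_on UNIV"
  shows "(\<forall>S \<in> K1 smul ip. (\<lambda>n. \<mu> n * eigval smul S n) summable_on UNIV)
    \<and> convex_on (K1 smul ip) (spectral_functional smul \<mu>)
    \<and> lower_semicontinuous_on (K1 smul ip) (spectral_functional smul \<mu>)"
proof -
  interpret hilbert_space smul ip by fact
  let ?K = "K1 smul ip"
  define mp where "mp k = \<mu> (int k + 1)" for k
  \<comment> \<open>The sign makes \<open>mn\<close> nonincreasing; in \<open>split\<close> it
    cancels against the sign change of the eigenvalues in passing to \<open>- S\<close>.\<close>
  define mn where "mn k = - \<mu> (- int k - 1)" for k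
  have mp: "mp (Suc k) \<le> mp k" and mn: "mn (Suc k) \<le> mn k" for k
    using assms(4)[of "int k + 1"] assms(5)[of "int k + 1"]
    by (simp_all add: mp_def mn_def add.commute[of 1] minus_diff_commute)
  have \<mu>_summable: "\<mu> summable_on UNIV"
    using assms(7) abs_summable_summable[of \<mu>] by simp
  have reindex: "summable (\<lambda>k. \<mu> (h k))" if "inj h" for h :: "nat \<Rightarrow> int"
  proof -
    have "(\<mu> \<circ> h) summable_on UNIV"
      using summable_on_reindex[OF that] summable_on_subset_banach[OF \<mu>_summable] by blast
    from summable_on_imp_summable[OF this] show ?thesis by (simp add: o_def)
  qed
  have mp_sum: "summable mp" and mn_sum: "summable mn"
    unfolding mp_def mn_def by (intro reindex summable_minus; simp add: inj_on_def)+
  have summable: "(\<lambda>n. \<mu> n * eigval smul S n) summable_on UNIV" if "S \<in> ?K" for S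
  proof -
    have "(\<lambda>n. \<bar>\<mu> n\<bar> * norm S) summable_on UNIV"
      using assms(7) by (intro summable_on_cmult_left)
    moreover have "norm (\<mu> n * eigval smul S n) \<le> \<bar>\<mu> n\<bar> * norm S" for n
      using abs_eigval_le[OF that] by (simp add: abs_mult mult_left_mono)
    ultimately show ?thesis
      by (rule abs_summable_summable[OF Infinite_Sum.abs_summable_on_comparison_test'])
  qed
  have split: "spectral_functional smul \<mu> S = positive_functional mp S + positive_functional mn (- S)"
    if S: "S \<in> ?K" for S
  proof -
    have "eigval smul (- S) (int k + 1) = - eigval smul S (- int k - 1)" for k
      by (simp add: eigval_uminus[OF S])
    then show ?thesis
      using infsum_int_split[OF summable[OF S]]
      by (simp add: spectral_functional_def positive_functional_def mp_def mn_def eigval_0[OF S])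
  qed
  have "convex ?K"
    by (auto simp: convex_def intro: K1_add K1_scaleR)
  moreover have "spectral_functional smul \<mu> (u *\<^sub>R S + v *\<^sub>R T)
      \<le> u * spectral_functional smul \<mu> S + v * spectral_functional smul \<mu> T"
    if S: "S \<in> ?K" and T: "T \<in> ?K" and uv: "0 \<le> u" "0 \<le> v" for S T u v
  proof -
    have "- (u *\<^sub>R S + v *\<^sub>R T) = u *\<^sub>R (- S) + v *\<^sub>R (- T)" by simp
    then show ?thesis
      using positive_functional_convex[OF mp mp_sum S T uv]
        positive_functional_convex[OF mn mn_sum K1_uminus[OF S] K1_uminus[OF T] uv]
      by (simp add: split S T K1_add K1_scaleR distrib_left)
  qed
  ultimately have "convex_on ?K (spectral_functional smul \<mu>)"
    by (simp add: convex_on_def)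
  moreover have "lower_semicontinuous_on ?K (spectral_functional smul \<mu>)"
    unfolding lower_semicontinuous_on_def
  proof (intro ballI allI impI)
    fix S Ss assume S: "S \<in> ?K" and Ss: "\<forall>n. Ss n \<in> ?K" and lim: "Ss \<longlonglongrightarrow> S"
    \<comment> \<open>Adding the Lipschitz constants of the two halves shows that the values
      converge, so the lower limit equals the value at \<open>S\<close>.\<close>
    let ?C = "suminf mp + suminf mn"
    have "norm (spectral_functional smul \<mu> (Ss n) - spectral_functional smul \<mu> S) \<le> ?C * norm (Ss n - S)" for n
      using positive_functional_lipschitz[OF mp mp_sum, of "Ss n" S]
        positive_functional_lipschitz[OF mn mn_sum, of "- Ss n" "- S"] S Ss
      by (simp add: split K1_uminus norm_minus_commute distrib_right abs_le_iff)
    moreover have "(\<lambda>n. ?C * norm (Ss n - S)) \<longlonglongrightarrow> 0"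
      using lim by (intro tendsto_mult_right_zero) (simp add: tendsto_norm_zero_iff LIM_zero_iff)
    ultimately have "(\<lambda>n. spectral_functional smul \<mu> (Ss n) - spectral_functional smul \<mu> S) \<longlonglongrightarrow> 0"
      by (rule Lim_null_comparison[OF always_eventually[OF allI]])
    then have "(\<lambda>n. ereal (spectral_functional smul \<mu> (Ss n))) \<longlonglongrightarrow> ereal (spectral_functional smul \<mu> S)"
      by (simp add: LIM_zero_iff)
    from lim_imp_Liminf[OF sequentially_bot this]
    show "ereal (spectral_functional smul \<mu> S) \<le> liminf (\<lambda>n. ereal (spectral_functional smul \<mu> (Ss n)))"
      by simp
  qed
  ultimately show ?thesis using summable by blast
qed

end
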